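(* Let $p, q \in \mathbb{N}$. Then $\mathrm{GA}(p,q)$ is an associative algebra over $\mathbb{R}$ with $\mathbf{1}$ as a two-sided unit. It has dimension $2^{p+q}$ as a real vector space and is generated as an algebra by the elements $\mathbf{e}_i$, $-q \le i < p$ ($i \in \mathbb{Z}$), which are linearly independent over $\mathbb{R}$ and satisfy, for all integers $i, j$ with $-q \le i, j < p$: \[ \mathbf{e}_i^2 = \mathbf{1} \ \text{ if } i \ge 0, \qquad \mathbf{e}_i^2 = -\mathbf{1} \ \text{ if } i < 0, \qquad \mathbf{e}_i\mathbf{e}_j = -\mathbf{e}_j\mathbf{e}_i \ \text{ if } i \neq j. \]
   Context: Let $\mathbb{F}\mathbb{Z}$ denote the set of all finite sets of integers, $\# A$ the number of elements of a finite set $A$, and $A \ominus B = (A \setminus B) \cup (B \setminus A)$ the symmetric difference of sets $A$ and $B$. The natural numbers $\mathbb{N}$ include $0$. Define functions $\alpha, \beta : \mathbb{F}\mathbb{Z} \times \mathbb{F}\mathbb{Z} \to \mathbb{N}$ and $\sigma : \mathbb{F}\mathbb{Z} \times \mathbb{F}\mathbb{Z} \to \{+1,-1\}$ by \[ \alpha(I,J) = \#\{(i,j) \mid i \in I,\ j \in J,\ j < i\}, \] \[ \beta(I,J) = \#\{i \mid i \in I,\ i \in J,\ i < 0\}, \] \[ \sigma(I,J) = (-1)^{\alpha(I,J)+\beta(I,J)}. \] $\mathrm{GA}(\infty,\infty)$ is the real vector space with a basis of symbols $\mathbf{e}_I$, one for each $I \in \mathbb{F}\mathbb{Z}$; so each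 element is uniquely a sum $\sum_{I \in \mathbb{F}\mathbb{Z}} \lambda_I \mathbf{e}_I$ with real coefficients $\lambda_I$, all but finitely many of which are $0$. Its multiplication is defined by \[ \Bigl(\sum_I \lambda_I \mathbf{e}_I\Bigr)\Bigl(\sum_J \mu_J \mathbf{e}_J\Bigr) = \sum_{I,J} \lambda_I \mu_J\, \sigma(I,J)\, \mathbf{e}_{I \ominus J}. \] Put $\mathbf{1} = \mathbf{e}_{\emptyset}$ and $\mathbf{e}_i = \mathbf{e}_{\{i\}}$ for each $i \in \mathbb{Z}$. With this multiplication $\mathrm{GA}(\infty,\infty)$ is an associative algebra over $\mathbb{R}$ with two-sided unit $\mathbf{1}$. For $p,q \in \mathbb{N}$, $\mathrm{GA}(p,q)$ is the subalgebra of $\mathrm{GA}(\infty,\infty)$ generated by the elements $\mathbf{e}_i$ with $-q \le i < p$; subalgebras, and generation as an algebra, are understood in the unital sense, i.e. subalgebras contain $\mathbf{1}$. *)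

theory Defs
  imports Complex_Main "HOL-Library.FSet"
begin

definition alpha :: "int fset \<Rightarrow> int fset \<Rightarrow> nat" where
  "alpha I J = card {(i, j). i |\<in>| I \<and> j |\<in>| J \<and> j < i}"

definition beta :: "int fset \<Rightarrow> int fset \<Rightarrow> nat" where
  "beta I J = card {i. i |\<in>| I \<and> i |\<in>| J \<and> i < 0}"

definition sigma :: "int fset \<Rightarrow> int fset \<Rightarrow> real" where
  "sigma I J = (- 1) ^ (alpha I J + beta I J)"

definition fsymdiff :: "int fset \<Rightarrow> int fset \<Rightarrow> int fset" where
  "fsymdiff I J = (I |-| J) |\<union>| (J |-| I)"

text \<open>
  The carrier of the algebra with infinitely many positive and negative generators: the real
  vector space of finitely supported coefficient functions on the finite sets of integers.
\<close>

typedef ga = "{f :: int fset \<Rightarrow> real. finite {I. f I \<noteq> 0}}"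
  morphisms coeff Abs_ga
  by (rule exI[of _ "\<lambda>_. 0"]) simp

setup_lifting type_definition_ga

instantiation ga :: real_vector
begin

lift_definition zero_ga :: ga is "\<lambda>_. 0" by simp

lift_definition plus_ga :: "ga \<Rightarrow> ga \<Rightarrow> ga" is "\<lambda>f g I. f I + g I"
proof -
  fix f g :: "int fset \<Rightarrow> real"
  assume "finite {I. f I \<noteq> 0}" "finite {I. g I \<noteq> 0}"
  then show "finite {I. f I + g I \<noteq> 0}"
    by (auto intro: finite_subset[of _ "{I. f I \<noteq> 0} \<union> {I. g I \<noteq> 0}"])
qed

lift_definition uminus_ga :: "ga \<Rightarrow> ga" is "\<lambda>f I. - f I" by simp

lift_definition minus_ga :: "ga \<Rightarrow> ga \<Rightarrow> ga" is "\<lambda>f g I. f I - g I"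
proof -
  fix f g :: "int fset \<Rightarrow> real"
  assume "finite {I. f I \<noteq> 0}" "finite {I. g I \<noteq> 0}"
  then show "finite {I. f I - g I \<noteq> 0}"
    by (auto intro: finite_subset[of _ "{I. f I \<noteq> 0} \<union> {I. g I \<noteq> 0}"])
qed

lift_definition scaleR_ga :: "real \<Rightarrow> ga \<Rightarrow> ga" is "\<lambda>c f I. c * f I"
  by (rule finite_subset) auto

instance
  by standard (transfer; simp add: algebra_simps fun_eq_iff)+

end

lift_definition blade :: "int fset \<Rightarrow> ga" is "\<lambda>I K. if K = I then 1 else 0"
  by simp

definition support :: "ga \<Rightarrow> int fset set" where
  "support x = {I. coeff x I \<noteq> 0}"

text \<open>
  Only the operations are introduced here: the type is deliberately not made an instance of any
  ring or algebra class, so that no algebraic law is built into the typing of later statements.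
\<close>

instantiation ga :: "{times, one}"
begin

definition times_ga :: "ga \<Rightarrow> ga \<Rightarrow> ga" where
  "x * y = (\<Sum>I\<in>support x. \<Sum>J\<in>support y.
              (coeff x I * coeff y J * sigma I J) *\<^sub>R blade (fsymdiff I J))"

definition one_ga :: ga where
  "1 = blade {||}"

instance ..

end

definition gen :: "int \<Rightarrow> ga" where
  "gen i = blade {|i|}"

definition subalgebra :: "'a::{real_vector, times, one} set \<Rightarrow> bool" where
  "subalgebra A \<longleftrightarrow> subspace A \<and> 1 \<in> A \<and> (\<forall>x\<in>A. \<forall>y\<in>A. x * y \<in> A)"

definition generated_subalgebra :: "'a::{real_vector, times, one} set \<Rightarrow> 'a set" where
  "generated_subalgebra X = \<Inter>{A. subalgebra A \<and> X \<subseteq> A}"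

text \<open>
  The set is an associative unital real algebra under the operations of the ambient type; the
  vector space laws hold because it is a subspace of a real vector space.
\<close>

definition assoc_unital_algebra :: "'a::{real_vector, times, one} set \<Rightarrow> bool" where
  "assoc_unital_algebra A \<longleftrightarrow>
     subspace A \<and>
     (\<forall>x\<in>A. \<forall>y\<in>A. x * y \<in> A) \<and>
     (\<forall>x\<in>A. \<forall>y\<in>A. \<forall>z\<in>A. (x + y) * z = x * z + y * z \<and> x * (y + z) = x * y + x * z) \<and>
     (\<forall>c. \<forall>x\<in>A. \<forall>y\<in>A. (c *\<^sub>R x) * y = c *\<^sub>R (x * y) \<and> x * (c *\<^sub>R y) = c *\<^sub>R (x * y)) \<and>
     (\<forall>x\<in>A. \<forall>y\<in>A. \<forall>z\<in>A. (x * y) * z = x * (y * z)) \<and>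
     1 \<in> A \<and> (\<forall>x\<in>A. 1 * x = x \<and> x * 1 = x)"

definition GA :: "nat \<Rightarrow> nat \<Rightarrow> ga set" where
  "GA p q = generated_subalgebra (gen ` {- int q..<int p})"

lemma coeff_sum: "coeff (sum f A) K = (\<Sum>a\<in>A. coeff (f a) K)"
  by (induction A rule: infinite_finite_induct) (simp_all add: zero_ga.rep_eq plus_ga.rep_eq)

lemma finite_support: "finite (support x)"
  using coeff[of x] by (simp add: support_def)

lemma blade_expansion: "x = (\<Sum>I\<in>support x. coeff x I *\<^sub>R blade I)"
proof -
  have "coeff (\<Sum>I\<in>support x. coeff x I *\<^sub>R blade I) K = coeff x K" for K
    using finite_support[of x]
    by (simp add: coeff_sum scaleR_ga.rep_eq blade.rep_eq support_def if_distrib cong: if_cong)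
  then show ?thesis
    by (metis coeff_inject ext)
qed

end

theory Submission
  imports Defs
begin

text \<open>
  The exponent in \<^term>\<open>sigma I J\<close> counts pairs, so the sign is a double product of values \<open>\<plusminus>1\<close> and
  hence multiplicative with respect to symmetric difference in each argument. Associativity on
  basis elements is the resulting cocycle identity. The subalgebra generated by the
  \<^term>\<open>gen i\<close> with \<open>i\<close> in an index set \<open>S\<close> is the span of the basis elements indexed by subsets
  of \<open>S\<close>: such an element is, up to sign, a product of generators, and this span is closed under
  multiplication. Its dimension is therefore the number of subsets of \<open>S\<close>.
\<close>

section \<open>Symmetric differences and the sign cocycle\<close>

lemma fset_fsymdiff: "fset (fsymdiff I J) = (fset I - fset J) \<union> (fset J - fset I)"
  by (simp add: fsymdiff_def)

lemma fsymdiff_assoc: "fsymdiff (fsymdiff I J) K = fsymdiff I (fsymdiff J K)"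
  unfolding fset_inject[symmetric] fset_fsymdiff by blast

lemma fsymdiff_commute: "fsymdiff I J = fsymdiff J I"
  unfolding fset_inject[symmetric] fset_fsymdiff by blast

lemma fsymdiff_fempty [simp]: "fsymdiff {||} I = I" "fsymdiff I {||} = I"
  unfolding fset_inject[symmetric] fset_fsymdiff by auto

text \<open>Elements of \<open>A \<inter> B\<close> occur in both factors on the right, where each
  contributes \<open>f x * f x = 1\<close>.\<close>

lemma prod_symdiff:
  fixes f :: "'a \<Rightarrow> 'b::comm_monoid_mult"
  assumes "finite A" "finite B" and sq: "\<And>x. f x * f x = 1"
  shows "prod f ((A - B) \<union> (B - A)) = prod f A * prod f B"
proof -
  have A: "prod f A = prod f (A - B) * prod f (A \<inter> B)"
    using assms by (subst prod.union_disjoint[symmetric]) (auto intro: arg_cong[of _ _ "prod f"])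
  have B: "prod f B = prod f (B - A) * prod f (A \<inter> B)"
    using assms by (subst prod.union_disjoint[symmetric]) (auto intro: arg_cong[of _ _ "prod f"])
  have I: "prod f (A \<inter> B) * prod f (A \<inter> B) = 1"
    by (simp add: prod.distrib[symmetric] sq)
  have "prod f A * prod f B
      = prod f (A - B) * prod f (B - A) * (prod f (A \<inter> B) * prod f (A \<inter> B))"
    unfolding A B by (simp only: ac_simps)
  also have "\<dots> = prod f ((A - B) \<union> (B - A))"
    using assms by (subst prod.union_disjoint) (auto simp: I)
  finally show ?thesis ..
qed

text \<open>This is the sign in the product of \<open>gen i\<close> and \<open>gen j\<close>: an
  inversion costs a sign as counted by \<open>alpha\<close>, and the diagonal case records the
  square \<open>- 1\<close> of a negative generator as counted by \<open>beta\<close>.\<close>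

definition pair_sign :: "int \<Rightarrow> int \<Rightarrow> real" where
  "pair_sign i j = (if j < i \<or> i = j \<and> i < 0 then - 1 else 1)"

lemma pair_sign_square [simp]: "pair_sign i j * pair_sign i j = 1"
  by (simp add: pair_sign_def)

lemma sigma_eq_prod: "sigma I J = (\<Prod>i\<in>fset I. \<Prod>j\<in>fset J. pair_sign i j)"
proof -
  define P where "P = fset I \<times> fset J"
  define A where "A = {(i, j). i |\<in>| I \<and> j |\<in>| J \<and> j < i}"
  define B where "B = {i. i |\<in>| I \<and> i |\<in>| J \<and> i < 0}"
  have fin: "finite P" "finite A" "finite B"
    by (auto simp: P_def A_def B_def intro: finite_subset[of _ "fset I \<times> fset J"]
        finite_subset[of _ "fset I"])
  \<comment> \<open>Placing \<open>B\<close> on the diagonal makes it disjoint from the strict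
    inversions in \<open>A\<close>, so the two counts merge into one count of the pairs with sign
    \<open>- 1\<close>.\<close>
  have "card A + card B = card A + card ((\<lambda>i. (i, i)) ` B)"
    by (simp add: card_image inj_on_def)
  also have "\<dots> = card (A \<union> (\<lambda>i. (i, i)) ` B)"
    using fin by (subst card_Un_disjoint) (auto simp: A_def)
  also have "A \<union> (\<lambda>i. (i, i)) ` B = {x \<in> P. snd x < fst x \<or> fst x = snd x \<and> fst x < 0}"
    by (auto simp: A_def B_def P_def)
  finally have "sigma I J
      = (\<Prod>x\<in>{x \<in> P. snd x < fst x \<or> fst x = snd x \<and> fst x < 0}. - 1)"
    by (simp add: sigma_def alpha_def beta_def A_def B_def)
  also have "\<dots> = (\<Prod>x\<in>P. pair_sign (fst x) (snd x))"
    unfolding pair_sign_def using fin(1) by (rule prod.inter_filter)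
  also have "\<dots> = (\<Prod>i\<in>fset I. \<Prod>j\<in>fset J. pair_sign i j)"
    by (simp add: P_def prod.cartesian_product case_prod_unfold)
  finally show ?thesis .
qed

lemma sigma_fsymdiff_left: "sigma (fsymdiff I J) K = sigma I K * sigma J K"
  unfolding sigma_eq_prod fset_fsymdiff
  by (rule prod_symdiff) (simp_all add: prod.distrib[symmetric])

lemma sigma_fsymdiff_right: "sigma I (fsymdiff J K) = sigma I J * sigma I K"
  by (simp add: sigma_eq_prod fset_fsymdiff prod_symdiff prod.distrib)

lemma sigma_fempty [simp]: "sigma {||} I = 1" "sigma I {||} = 1"
  by (simp_all add: sigma_eq_prod)

lemma sigma_nonzero: "sigma I J \<noteq> 0"
  by (simp add: sigma_def)

lemma sigma_singletons: "sigma {|i|} {|j|} = pair_sign i j"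
  by (simp add: sigma_eq_prod)

section \<open>Blades as a basis\<close>

lemma coeff_blade: "coeff (blade I) K = (if K = I then 1 else 0)"
  by (simp add: blade.rep_eq)

lemma inj_blade: "inj blade"
  by (rule injI) (metis coeff_blade zero_neq_one)

lemma span_blade: "span (range blade) = UNIV"
proof -
  have "x \<in> span (range blade)" for x
    by (subst blade_expansion) (intro span_sum span_scale span_base rangeI)
  then show ?thesis by blast
qed

lemma independent_blade: "independent (range blade)"
proof -
  have "u b = 0" if fin: "finite T" and T: "T \<subseteq> range blade"
    and zero: "(\<Sum>v\<in>T. u v *\<^sub>R v) = 0" and b: "b \<in> T" for T b and u :: "ga \<Rightarrow> real"
  proof -
    obtain I where I: "b = blade I" using T b by auto
    \<comment> \<open>The coefficient at \<open>I\<close> vanishes on every blade but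
      \<open>b\<close>, so applying it to the linear relation isolates \<open>u b\<close>.\<close>
    have "coeff v I = (if v = b then 1 else 0)" if "v \<in> T" for v
      using subsetD[OF T that] I by (auto simp: coeff_blade)
    then have coeff_T: "(\<Sum>v\<in>T. coeff (u v *\<^sub>R v) I) = (\<Sum>v\<in>T. if v = b then u b else 0)"
      by (intro sum.cong) (auto simp: scaleR_ga.rep_eq)
    have "0 = coeff (\<Sum>v\<in>T. u v *\<^sub>R v) I"
      by (simp add: zero zero_ga.rep_eq)
    also have "\<dots> = (\<Sum>v\<in>T. if v = b then u b else 0)"
      by (simp add: coeff_sum coeff_T)
    also have "\<dots> = u b" using fin b by simp
    finally show ?thesis by simp
  qed
  then show ?thesis
    unfolding dependent_explicit by blast
qed

section \<open>Bilinearity of the product\<close>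

lemma times_eq_sum:
  assumes "finite A" "support x \<subseteq> A" "finite B" "support y \<subseteq> B"
  shows "x * y = (\<Sum>I\<in>A. \<Sum>J\<in>B. (coeff x I * coeff y J * sigma I J) *\<^sub>R blade (fsymdiff I J))"
proof -
  let ?t = "\<lambda>I J. (coeff x I * coeff y J * sigma I J) *\<^sub>R blade (fsymdiff I J)"
  have "x * y = (\<Sum>I\<in>support x. \<Sum>J\<in>B. ?t I J)"
    unfolding times_ga_def using assms
    by (intro sum.cong refl sum.mono_neutral_left) (auto simp: support_def)
  also have "\<dots> = (\<Sum>I\<in>A. \<Sum>J\<in>B. ?t I J)"
    using assms by (intro sum.mono_neutral_left) (auto simp: support_def)
  finally show ?thesis .
qed

lemma support_add: "support (x + y) \<subseteq> support x \<union> support y"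
  by (auto simp: support_def plus_ga.rep_eq)

lemma support_scaleR: "support (c *\<^sub>R x) \<subseteq> support x"
  by (auto simp: support_def scaleR_ga.rep_eq)

lemma linear_times_left: "linear (\<lambda>x::ga. x * y)"
proof (rule linearI)
  fix x x' :: ga and c :: real
  let ?A = "support x \<union> support x'" and ?B = "support y"
  have "(x + x') * y = (\<Sum>I\<in>?A. \<Sum>J\<in>?B.
      (coeff (x + x') I * coeff y J * sigma I J) *\<^sub>R blade (fsymdiff I J))"
    by (intro times_eq_sum) (simp_all add: finite_support support_add)
  \<comment> \<open>The supports of \<open>x\<close>, \<open>x'\<close> and their sum may all
    differ. Over the common index sets \<open>?A\<close> and \<open>?B\<close> the products can be
    compared term by term.\<close>
  also have "\<dots> = x * y + x' * y"
    by (subst (1 2) times_eq_sum[of ?A _ ?B])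
      (simp_all add: finite_support plus_ga.rep_eq sum.distrib algebra_simps)
  finally show "(x + x') * y = x * y + x' * y" .
  have "(c *\<^sub>R x) * y = (\<Sum>I\<in>support x. \<Sum>J\<in>?B.
      (coeff (c *\<^sub>R x) I * coeff y J * sigma I J) *\<^sub>R blade (fsymdiff I J))"
    by (intro times_eq_sum) (simp_all add: finite_support support_scaleR)
  also have "\<dots> = c *\<^sub>R (x * y)"
    by (simp add: times_ga_def scaleR_ga.rep_eq scaleR_sum_right mult.assoc)
  finally show "(c *\<^sub>R x) * y = c *\<^sub>R (x * y)" .
qed

lemma linear_times_right: "linear (\<lambda>y::ga. x * y)"
proof (rule linearI)
  fix y y' :: ga and c :: real
  let ?A = "support x" and ?B = "support y \<union> support y'"
  have "x * (y + y') = (\<Sum>I\<in>?A. \<Sum>J\<in>?B.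
      (coeff x I * coeff (y + y') J * sigma I J) *\<^sub>R blade (fsymdiff I J))"
    by (intro times_eq_sum) (simp_all add: finite_support support_add)
  also have "\<dots> = x * y + x * y'"
    by (subst (1 2) times_eq_sum[of ?A _ ?B])
      (simp_all add: finite_support plus_ga.rep_eq sum.distrib algebra_simps)
  finally show "x * (y + y') = x * y + x * y'" .
  have "x * (c *\<^sub>R y) = (\<Sum>I\<in>?A. \<Sum>J\<in>support y.
      (coeff x I * coeff (c *\<^sub>R y) J * sigma I J) *\<^sub>R blade (fsymdiff I J))"
    by (intro times_eq_sum) (simp_all add: finite_support support_scaleR)
  also have "\<dots> = c *\<^sub>R (x * y)"
    by (simp add: times_ga_def scaleR_ga.rep_eq scaleR_sum_right mult.left_commute mult.assoc)
  finally show "x * (c *\<^sub>R y) = c *\<^sub>R (x * y)" .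
qed

section \<open>Unit laws and associativity\<close>

lemma blade_times_blade: "blade I * blade J = sigma I J *\<^sub>R blade (fsymdiff I J)"
  by (subst times_eq_sum[of "{I}" _ "{J}"]) (auto simp: support_def coeff_blade split: if_splits)

text \<open>Since blades span the space, this reduces the multilinear laws to basis elements, one
  argument at a time.\<close>

lemma ga_eq_on_blades:
  assumes "linear f" "linear g" "\<And>I. f (blade I) = g (blade I)"
  shows "f x = g x"
  by (rule linear_eq_on_span[of f g "range blade"]) (use assms span_blade in auto)

lemma ga_one_left: "1 * x = (x::ga)"
  by (rule ga_eq_on_blades[where f = "\<lambda>x. 1 * x"])
    (simp_all add: linear_times_right linear_ident one_ga_def blade_times_blade)

lemma ga_one_right: "x * 1 = (x::ga)"
  by (rule ga_eq_on_blades[where f = "\<lambda>x. x * 1"])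
    (simp_all add: linear_times_left linear_ident one_ga_def blade_times_blade)

lemma ga_times_assoc: "(x * y) * z = x * (y * z)" for x y z :: ga
proof -
  \<comment> \<open>Both sides carry the sign \<open>sigma I J * sigma I K * sigma J K\<close>, by
    multiplicativity of \<open>sigma\<close> in each argument.\<close>
  have blades: "(blade I * blade J) * blade K = blade I * (blade J * blade K)" for I J K
    by (simp add: blade_times_blade linear_scale[OF linear_times_left]
        linear_scale[OF linear_times_right] sigma_fsymdiff_left sigma_fsymdiff_right fsymdiff_assoc)
  note lin = linear_times_left linear_times_right
    linear_compose[OF linear_times_left linear_times_left, unfolded o_def]
    linear_compose[OF linear_times_left linear_times_right, unfolded o_def]
    linear_compose[OF linear_times_right linear_times_left, unfolded o_def]
    linear_compose[OF linear_times_right linear_times_right, unfolded o_def]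
  \<comment> \<open>The identity is extended linearly in \<open>z\<close>, then in \<open>y\<close>,
    then in \<open>x\<close>. In the later two steps \<open>rotated 2\<close> puts the premise about
    blades first, to be met by the chained fact.\<close>
  have "(blade I * blade J) * z = blade I * (blade J * z)" for I J z
    by (rule ga_eq_on_blades) (rule lin blades)+
  then have "(blade I * y) * z = blade I * (y * z)" for I y z
    by (rule ga_eq_on_blades[rotated 2]) (rule lin)+
  then show ?thesis
    by (rule ga_eq_on_blades[rotated 2]) (rule lin)+
qed

section \<open>The generated subalgebra and its dimension\<close>

definition blades_on :: "int set \<Rightarrow> ga set" where
  "blades_on S = blade ` {I. fset I \<subseteq> S}"

lemma span_blades_on_closed:
  assumes "x \<in> span (blades_on S)" "y \<in> span (blades_on S)"
  shows "x * y \<in> span (blades_on S)"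
proof -
  let ?V = "span (blades_on S)"
  have blades: "b * b' \<in> ?V" if b: "b \<in> blades_on S" "b' \<in> blades_on S" for b b'
  proof -
    obtain I J where IJ: "b = blade I" "b' = blade J" "fset I \<subseteq> S" "fset J \<subseteq> S"
      using b by (auto simp: blades_on_def)
    then have "fset (fsymdiff I J) \<subseteq> S"
      by (auto simp: fset_fsymdiff)
    then show ?thesis
      by (simp add: IJ(1,2) blade_times_blade blades_on_def span_scale span_base)
  qed
  \<comment> \<open>Preimages of \<open>?V\<close> under one-sided multiplication are subspaces, so
    span induction applies to the right factor and then to the left one.\<close>
  have subspaces: "subspace {y. x * y \<in> ?V}" "subspace {x. x * y \<in> ?V}" for x y
    using linear_subspace_vimage[OF linear_times_right[of x] subspace_span[of "blades_on S"]]
      linear_subspace_vimage[OF linear_times_left[of y] subspace_span[of "blades_on S"]]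
    by (simp_all only: vimage_def)
  have "b * y \<in> ?V" if "b \<in> blades_on S" for b
    using assms(2) subspaces(1) blades[OF that] by (rule span_induct)
  with assms(1) subspaces(2) show ?thesis
    by (rule span_induct)
qed

lemma subalgebra_span_blades_on: "subalgebra (span (blades_on S))"
proof -
  have "1 \<in> blades_on S"
    by (simp add: one_ga_def blades_on_def)
  then show ?thesis
    by (simp add: subalgebra_def span_base span_blades_on_closed)
qed

text \<open>Elements of \<open>I\<close> may be inserted in any order: multiplying by
  \<open>gen i\<close> on the left yields the larger blade up to a nonzero scalar, which the
  subalgebra absorbs.\<close>

lemma blade_in_subalgebra:
  assumes "subalgebra A" "gen ` S \<subseteq> A" "fset I \<subseteq> S"
  shows "blade I \<in> A"
  using assms(3)
proof (induction I)
  case empty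
  then show ?case
    using assms(1) by (simp add: subalgebra_def one_ga_def)
next
  case (insert i I)
  have "fsymdiff {|i|} I = finsert i I"
    using insert.hyps unfolding fset_inject[symmetric] fset_fsymdiff by auto
  then have "blade (finsert i I) = inverse (sigma {|i|} I) *\<^sub>R (gen i * blade I)"
    by (simp add: gen_def blade_times_blade sigma_nonzero)
  moreover have "gen i * blade I \<in> A"
    using assms(1,2) insert by (auto simp: subalgebra_def)
  ultimately show ?case
    using assms(1) by (simp add: subalgebra_def subspace_scale)
qed

text \<open>The span is itself a subalgebra containing the generators, which gives one inclusion;
  every competing subalgebra contains all blades on \<open>S\<close>, which gives the other.\<close>

lemma generated_subalgebra_gen: "generated_subalgebra (gen ` S) = span (blades_on S)"
proof
  have "gen ` S \<subseteq> span (blades_on S)"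
    by (auto simp: gen_def blades_on_def intro!: span_base)
  then show "generated_subalgebra (gen ` S) \<subseteq> span (blades_on S)"
    using subalgebra_span_blades_on by (auto simp: generated_subalgebra_def)
  have "span (blades_on S) \<subseteq> A" if "subalgebra A" "gen ` S \<subseteq> A" for A
    using that by (intro span_minimal) (auto simp: blades_on_def blade_in_subalgebra subalgebra_def)
  then show "span (blades_on S) \<subseteq> generated_subalgebra (gen ` S)"
    by (auto simp: generated_subalgebra_def)
qed

lemma dim_span_blades_on:
  assumes "finite S"
  shows "dim (span (blades_on S)) = 2 ^ card S"
proof -
  have "independent (blades_on S)"
    using independent_blade by (rule independent_mono) (auto simp: blades_on_def)
  then have "dim (span (blades_on S)) = card (blades_on S)"
    by (rule dim_span_eq_card_independent)
  also have "\<dots> = card {I. fset I \<subseteq> S}"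
    unfolding blades_on_def using inj_blade by (intro card_image) (auto intro: inj_on_subset)
  also have "\<dots> = card (fset ` {I. fset I \<subseteq> S})"
    by (simp add: card_image inj_on_def fset_inject)
  also have "fset ` {I. fset I \<subseteq> S} = Pow S"
  proof
    \<comment> \<open>Finiteness of \<open>S\<close> enters here: each of its subsets is finite and
      hence comes from an \<open>fset\<close>.\<close>
    show "Pow S \<subseteq> fset ` {I. fset I \<subseteq> S}"
    proof
      fix T assume "T \<in> Pow S"
      then have "T = fset (Abs_fset T)" "T \<subseteq> S"
        using assms finite_subset[of T S] by (simp_all add: Abs_fset_inverse)
      then show "T \<in> fset ` {I. fset I \<subseteq> S}"
        by (metis (mono_tags) imageI mem_Collect_eq)
    qed
  qed auto
  finally show ?thesis
    by (simp add: card_Pow assms)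
qed

section \<open>Algebra laws and relations between the generators\<close>

lemma assoc_unital_algebra_subalgebra:
  "assoc_unital_algebra A" if "subalgebra A" for A :: "ga set"
  using that
  by (simp add: subalgebra_def assoc_unital_algebra_def ga_one_left ga_one_right ga_times_assoc
      linear_add[OF linear_times_left] linear_add[OF linear_times_right]
      linear_scale[OF linear_times_left] linear_scale[OF linear_times_right])

text \<open>Independence of an image set does not exclude repetitions in the family. Injectivity
  rules them out, so the generators are independent as an indexed family.\<close>

lemma inj_gen: "inj gen"
  using inj_blade by (auto simp: inj_def gen_def)

lemma independent_gen: "independent (gen ` S)"
  using independent_blade by (rule independent_mono) (auto simp: gen_def)

lemma gen_times_self: "gen i * gen i = (if i < 0 then - 1 else 1)"
proof -
  have "fsymdiff {|i|} {|i|} = {||}"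
    by (simp add: fsymdiff_def)
  then show ?thesis
    by (simp add: gen_def blade_times_blade sigma_singletons pair_sign_def one_ga_def)
qed

text \<open>Both products are multiples of the same blade, and exactly one of the orders
  \<open>(i, j)\<close> and \<open>(j, i)\<close> is an inversion, so the signs are
  opposite.\<close>

lemma gen_times_gen_anticommute: "gen i * gen j = - (gen j * gen i)" if "i \<noteq> j"
  using that fsymdiff_commute[of "{|i|}" "{|j|}"]
  by (auto simp: gen_def blade_times_blade sigma_singletons pair_sign_def)

theorem theorem2:
  fixes p q :: nat
  shows "assoc_unital_algebra (GA p q) \<and>
    dim (GA p q) = 2 ^ (p + q) \<and>
    GA p q = generated_subalgebra (gen ` {- int q..<int p}) \<and>
    inj_on gen {- int q..<int p} \<and>
    independent (gen ` {- int q..<int p}) \<and>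
    (\<forall>i\<in>{- int q..<int p}. i \<ge> 0 \<longrightarrow> gen i * gen i = 1) \<and>
    (\<forall>i\<in>{- int q..<int p}. i < 0 \<longrightarrow> gen i * gen i = - 1) \<and>
    (\<forall>i\<in>{- int q..<int p}. \<forall>j\<in>{- int q..<int p}. i \<noteq> j \<longrightarrow> gen i * gen j = - (gen j * gen i))"
proof -
  let ?S = "{- int q..<int p}"
  have GA: "GA p q = span (blades_on ?S)"
    by (simp add: GA_def generated_subalgebra_gen)
  have "dim (GA p q) = 2 ^ (p + q)"
    unfolding GA by (subst dim_span_blades_on) (simp_all add: nat_add_distrib)
  moreover have "assoc_unital_algebra (GA p q)"
    by (simp add: GA assoc_unital_algebra_subalgebra subalgebra_span_blades_on)
  moreover have "inj_on gen ?S"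
    using inj_gen by (rule inj_on_subset) simp
  ultimately show ?thesis
    by (intro conjI ballI impI gen_times_gen_anticommute)
      (simp_all add: GA_def gen_times_self independent_gen)
qed

end
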